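(* For IBCI-algebras $\langle\mathbb{A},\Rightarrow\!\!>,\Rightarrow,[\top,\top]\rangle$, with $X\ll Y$ iff $X\Rightarrow\!\!> Y=[\top,\top]$ and $X\precsim Y$ iff $X\Rightarrow Y=[\top,\top]$, the properties "$X\ll Y$ if and only if $X\Rightarrow Y=[\top,\top]$" and "$X\precsim Y$ if and only if $X\Rightarrow\!\!> Y=[\top,\top]$" do not hold in general (for all $X,Y$). However, in every IBCI-algebra, for all $X,Y\in\mathbb{A}$: (a) if $X\ll Y$ then $X\Rightarrow Y=[\top,\top]$; (b) if $X\Rightarrow\!\!> Y=[\top,\top]$ then $X\precsim Y$.
   Context: A BCI-algebra is a structure $\langle A,\rightarrow,\top\rangle$ such that for all $x,y,z\in A$: (C1) $(y\rightarrow z)\rightarrow((z\rightarrow x)\rightarrow(y\rightarrow x))=\top$; (C2) $x\rightarrow((x\rightarrow y)\rightarrow y)=\top$; (C3) $x\rightarrow x=\top$; (C4) $x\rightarrow y=\top$ and $y\rightarrow x=\top$ imply $x=y$; its induced order is $x\preceq y$ iff $x\rightarrow y=\top$. Given such an algebra with $\langle A,\preceq\rangle$ a meet-semilattice and $x\rightarrow(y\wedge z)=(x\rightarrow y)\wedge(x\rightarrow z)$ for all $x,y,z$, let $\mathbb{A}=\{[a,b]:a,b\in A,\ a\preceq b\}$, $\underline{[a,b]}=a$, $\overline{[a,b]}=b$. Define $X\Rightarrow\!\!> Y=[\overline{X}\rightarrow\underline{Y},\ \underline{X}\rightarrow\overline{Y}]$ and $X\Rightarrow Y=[(\underline{X}\rightarrow\underline{Y})\wedge(\overline{X}\rightarrow\overline{Y}),\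 \underline{X}\rightarrow\overline{Y}]$; $\langle\mathbb{A},\Rightarrow\!\!>,\Rightarrow,[\top,\top]\rangle$ is the IBCI-algebra obtained from $\langle A,\rightarrow,\top\rangle$. *)

theory Defs
  imports "HOL-Algebra.Lattice"
begin

record 'a bci = "'a partial_object" +
  bci_imp :: "'a \<Rightarrow> 'a \<Rightarrow> 'a"  (infixr \<open>\<leadsto>\<index>\<close> 65)
  bci_top :: 'a

locale bci_algebra =
  fixes B :: "('a, 'm) bci_scheme" (structure)
  assumes top_closed: "bci_top B \<in> carrier B"
    and imp_closed: "\<lbrakk>x \<in> carrier B; y \<in> carrier B\<rbrakk> \<Longrightarrow> x \<leadsto> y \<in> carrier B"
    and C1: "\<lbrakk>x \<in> carrier B; y \<in> carrier B; z \<in> carrier B\<rbrakk>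
      \<Longrightarrow> (y \<leadsto> z) \<leadsto> ((z \<leadsto> x) \<leadsto> (y \<leadsto> x)) = bci_top B"
    and C2: "\<lbrakk>x \<in> carrier B; y \<in> carrier B\<rbrakk>
      \<Longrightarrow> x \<leadsto> ((x \<leadsto> y) \<leadsto> y) = bci_top B"
    and C3: "x \<in> carrier B \<Longrightarrow> x \<leadsto> x = bci_top B"
    and C4: "\<lbrakk>x \<in> carrier B; y \<in> carrier B; x \<leadsto> y = bci_top B; y \<leadsto> x = bci_top B\<rbrakk>
      \<Longrightarrow> x = y"

definition bci_order :: "('a, 'm) bci_scheme \<Rightarrow> 'a gorder" where
  "bci_order B = \<lparr>carrier = carrier B, eq = (=), le = (\<lambda>x y. x \<leadsto>\<^bsub>B\<^esub> y = bci_top B)\<rparr>"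

abbreviation bci_meet :: "('a, 'm) bci_scheme \<Rightarrow> 'a \<Rightarrow> 'a \<Rightarrow> 'a" where
  "bci_meet B x y \<equiv> x \<sqinter>\<^bsub>bci_order B\<^esub> y"

locale semilattice_bci_algebra = bci_algebra B
  for B :: "('a, 'm) bci_scheme" (structure) +
  assumes meet_semilattice: "lower_semilattice (bci_order B)"
    and imp_meet: "\<lbrakk>x \<in> carrier B; y \<in> carrier B; z \<in> carrier B\<rbrakk>
      \<Longrightarrow> x \<leadsto> bci_meet B y z = bci_meet B (x \<leadsto> y) (x \<leadsto> z)"

abbreviation bci_interval :: "('a, 'm) bci_scheme \<Rightarrow> 'a \<Rightarrow> 'a \<Rightarrow> 'a set" where
  "bci_interval B a b \<equiv> \<lbrace>a..b\<rbrace>\<^bsub>bci_order B\<^esub>"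

definition bci_intervals :: "('a, 'm) bci_scheme \<Rightarrow> 'a set set" where
  "bci_intervals B = {bci_interval B a b | a b.
     a \<in> carrier B \<and> b \<in> carrier B \<and> a \<sqsubseteq>\<^bsub>bci_order B\<^esub> b}"

text \<open>Intervals are sets of elements, so their endpoints are recovered as their least and
  greatest elements; see \<open>lo_interval\<close> and \<open>hi_interval\<close> below.\<close>

definition lo :: "('a, 'm) bci_scheme \<Rightarrow> 'a set \<Rightarrow> 'a" where
  "lo B X = (THE a. least (bci_order B) a X)"

definition hi :: "('a, 'm) bci_scheme \<Rightarrow> 'a set \<Rightarrow> 'a" where
  "hi B X = (THE b. greatest (bci_order B) b X)"

text \<open>In the record below, \<open>ibci_wimp\<close> is the double-headed arrow and \<open>ibci_imp\<close> the
  single-headed one.\<close>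

record 'i ibci = "'i partial_object" +
  ibci_wimp :: "'i \<Rightarrow> 'i \<Rightarrow> 'i"
  ibci_imp :: "'i \<Rightarrow> 'i \<Rightarrow> 'i"
  ibci_top :: 'i

definition ibci_of :: "('a, 'm) bci_scheme \<Rightarrow> 'a set ibci" where
  "ibci_of B = \<lparr>
     carrier = bci_intervals B,
     ibci_wimp = (\<lambda>X Y. bci_interval B (hi B X \<leadsto>\<^bsub>B\<^esub> lo B Y) (lo B X \<leadsto>\<^bsub>B\<^esub> hi B Y)),
     ibci_imp = (\<lambda>X Y. bci_interval B
       (bci_meet B (lo B X \<leadsto>\<^bsub>B\<^esub> lo B Y) (hi B X \<leadsto>\<^bsub>B\<^esub> hi B Y)) (lo B X \<leadsto>\<^bsub>B\<^esub> hi B Y)),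
     ibci_top = bci_interval B (bci_top B) (bci_top B)\<rparr>"

definition ibci_algebra :: "'a set ibci \<Rightarrow> bool" where
  "ibci_algebra I \<longleftrightarrow> (\<exists>B :: 'a bci. semilattice_bci_algebra B \<and> I = ibci_of B)"

definition ibci_ll :: "'i ibci \<Rightarrow> 'i \<Rightarrow> 'i \<Rightarrow> bool" where
  "ibci_ll I X Y \<longleftrightarrow> ibci_wimp I X Y = ibci_top I"

definition ibci_precsim :: "'i ibci \<Rightarrow> 'i \<Rightarrow> 'i \<Rightarrow> bool" where
  "ibci_precsim I X Y \<longleftrightarrow> ibci_imp I X Y = ibci_top I"

context semilattice_bci_algebra
begin

interpretation L: lower_semilattice "bci_order B"
  by (rule meet_semilattice)

lemma carrier_order: "carrier (bci_order B) = carrier B"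
  by (simp add: bci_order_def)

lemma le_iff: "x \<sqsubseteq>\<^bsub>bci_order B\<^esub> y \<longleftrightarrow> x \<leadsto> y = bci_top B"
  by (simp add: bci_order_def)

lemma
  assumes "a \<in> carrier B" "b \<in> carrier B" "a \<sqsubseteq>\<^bsub>bci_order B\<^esub> b"
  shows lo_interval: "lo B (bci_interval B a b) = a"
    and hi_interval: "hi B (bci_interval B a b) = b"
proof -
  have l: "least (bci_order B) a (bci_interval B a b)"
    and g: "greatest (bci_order B) b (bci_interval B a b)"
    using assms
    by (auto simp: least_def greatest_def at_least_at_most_def carrier_order L.le_refl)
  show "lo B (bci_interval B a b) = a"
    unfolding lo_def using l L.least_unique by blast
  show "hi B (bci_interval B a b) = b"
    unfolding hi_def using g L.greatest_unique by blast
qed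

lemma imp_top: assumes "t \<in> carrier B" shows "bci_top B \<leadsto> t = t"
proof (rule C4)
  let ?T = "bci_top B"
  have *: "u = ?T" if u: "u \<in> carrier B" "?T \<leadsto> u = ?T" for u
    using C2[of u u] C3[of u] C4[of u ?T] u top_closed by simp
  show "(?T \<leadsto> t) \<leadsto> t = ?T"
    using *[of "(?T \<leadsto> t) \<leadsto> t"] C2[of ?T t] assms top_closed imp_closed by simp
  show "t \<leadsto> (?T \<leadsto> t) = ?T"
    using C2[of t t] C3[of t] assms by simp
qed (use assms top_closed imp_closed in auto)

lemma imp_antimono:
  assumes "x \<in> carrier B" "y \<in> carrier B" "z \<in> carrier B" "y \<sqsubseteq>\<^bsub>bci_order B\<^esub> z"
  shows "(z \<leadsto> x) \<sqsubseteq>\<^bsub>bci_order B\<^esub> (y \<leadsto> x)"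
  using C1[of x y z] assms imp_top imp_closed by (simp add: le_iff)

lemma imp_mono:
  assumes "x \<in> carrier B" "y \<in> carrier B" "z \<in> carrier B" "z \<sqsubseteq>\<^bsub>bci_order B\<^esub> x"
  shows "(y \<leadsto> z) \<sqsubseteq>\<^bsub>bci_order B\<^esub> (y \<leadsto> x)"
  using C1[of x y z] assms imp_top imp_closed by (simp add: le_iff)

lemma ibci_of_closed:
  assumes "X \<in> carrier (ibci_of B)" "Y \<in> carrier (ibci_of B)"
  shows "ibci_wimp (ibci_of B) X Y \<in> carrier (ibci_of B)"
    and "ibci_imp (ibci_of B) X Y \<in> carrier (ibci_of B)"
    and "ibci_top (ibci_of B) \<in> carrier (ibci_of B)"
proof -
  let ?le = "\<lambda>x y. x \<sqsubseteq>\<^bsub>bci_order B\<^esub> y"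
  obtain a b where X: "X = bci_interval B a b" "a \<in> carrier B" "b \<in> carrier B" "?le a b"
    using assms(1) by (auto simp: ibci_of_def bci_intervals_def)
  obtain c d where Y: "Y = bci_interval B c d" "c \<in> carrier B" "d \<in> carrier B" "?le c d"
    using assms(2) by (auto simp: ibci_of_def bci_intervals_def)
  note ends = X(1) Y(1) lo_interval hi_interval X(2-4) Y(2-4)
  have in_B: "b \<leadsto> c \<in> carrier B" "a \<leadsto> c \<in> carrier B" "a \<leadsto> d \<in> carrier B" "b \<leadsto> d \<in> carrier B"
    using X Y imp_closed by auto
  have le1: "?le (b \<leadsto> c) (a \<leadsto> c)" and le2: "?le (a \<leadsto> c) (a \<leadsto> d)"
    using X Y imp_antimono imp_mono by auto
  have le3: "?le (b \<leadsto> c) (a \<leadsto> d)"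
    using L.le_trans[OF le1 le2] in_B by (simp add: carrier_order)
  have m: "bci_meet B (a \<leadsto> c) (b \<leadsto> d) \<in> carrier B"
    using L.meet_closed in_B by (simp add: carrier_order)
  have le4: "?le (bci_meet B (a \<leadsto> c) (b \<leadsto> d)) (a \<leadsto> d)"
    using L.le_trans[OF L.meet_left le2] in_B m by (simp add: carrier_order)
  show "ibci_wimp (ibci_of B) X Y \<in> carrier (ibci_of B)"
    using le3 in_B by (auto simp: ibci_of_def bci_intervals_def ends)
  show "ibci_imp (ibci_of B) X Y \<in> carrier (ibci_of B)"
    using le4 m in_B by (auto simp: ibci_of_def bci_intervals_def ends)
  show "ibci_top (ibci_of B) \<in> carrier (ibci_of B)"
    using top_closed C3 by (auto simp: ibci_of_def bci_intervals_def le_iff)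
qed

end

end

theory Submission
  imports Defs
begin

text \<open>If \<open>[a, b] \<ll> [c, d]\<close> then \<open>b \<preceq> c\<close>, so \<open>a \<preceq> b \<preceq> c \<preceq> d\<close> and both
  implications whose meet is the lower end of \<open>[a, b] \<Rightarrow> [c, d]\<close> are \<open>\<top>\<close>. The converse fails on
  the diagonal: \<open>X \<precsim> X\<close> always holds, whereas \<open>X \<ll> X\<close> forces \<open>X\<close> to be degenerate.\<close>

context semilattice_bci_algebra
begin

interpretation L: lower_semilattice "bci_order B"
  by (rule meet_semilattice)

text \<open>Serves to collapse the lower end of \<open>ibci_imp\<close> when both implications under
  the meet equal \<top>.\<close>

lemma meet_idem: "x \<in> carrier B \<Longrightarrow> bci_meet B x x = x"
  using L.meet_le[of x x x] L.meet_left[of x x] L.le_antisym[of x "bci_meet B x x"] L.meet_closed[of x x]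
  by (simp add: carrier_order)

lemma
  assumes "X \<in> carrier (ibci_of B)"
  shows lo_closed: "lo B X \<in> carrier B"
    and hi_closed: "hi B X \<in> carrier B"
    and lo_imp_hi: "lo B X \<leadsto> hi B X = bci_top B"
proof -
  obtain a b where "X = bci_interval B a b" "a \<in> carrier B" "b \<in> carrier B"
    "a \<sqsubseteq>\<^bsub>bci_order B\<^esub> b"
    using assms by (auto simp: ibci_of_def bci_intervals_def)
  then show "lo B X \<in> carrier B" "hi B X \<in> carrier B" "lo B X \<leadsto> hi B X = bci_top B"
    by (simp_all add: lo_interval hi_interval flip: le_iff)
qed

lemma imp_trans_top:
  assumes "x \<in> carrier B" "y \<in> carrier B" "z \<in> carrier B"
    and "x \<leadsto> y = bci_top B" "y \<leadsto> z = bci_top B"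
  shows "x \<leadsto> z = bci_top B"
  using L.le_trans[of x y z] assms by (simp add: carrier_order le_iff)

text \<open>Equal intervals have equal lower ends, which gives one direction. Conversely, once the
  lower end is \<top>, the upper end is forced to be \<top> as well.\<close>

lemma wimp_top_iff:
  assumes "X \<in> carrier (ibci_of B)" "Y \<in> carrier (ibci_of B)"
  shows "ibci_wimp (ibci_of B) X Y = ibci_top (ibci_of B) \<longleftrightarrow> hi B X \<leadsto> lo B Y = bci_top B"
proof -
  define a b c d where "a = lo B X" "b = hi B X" "c = lo B Y" "d = hi B Y"
  note ends = this
  note closed = lo_closed[OF assms(1), folded ends] hi_closed[OF assms(1), folded ends]
    lo_closed[OF assms(2), folded ends] hi_closed[OF assms(2), folded ends]
  note le = lo_imp_hi[OF assms(1), folded ends] lo_imp_hi[OF assms(2), folded ends]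
  have w: "ibci_wimp (ibci_of B) X Y = bci_interval B (b \<leadsto> c) (a \<leadsto> d)"
    by (simp add: ibci_of_def ends)
  have t: "ibci_top (ibci_of B) = bci_interval B (bci_top B) (bci_top B)"
    by (simp add: ibci_of_def)
  \<comment> \<open>\<open>lo_interval\<close> recovers an end only from correctly ordered ends, so
    \<open>b \<leadsto> c\<close> is first placed below \<open>a \<leadsto> d\<close>, passing
    through \<open>a \<leadsto> c\<close>.\<close>
  have "(b \<leadsto> c) \<leadsto> (a \<leadsto> c) = bci_top B" "(a \<leadsto> c) \<leadsto> (a \<leadsto> d) = bci_top B"
    using imp_antimono[of c a b] imp_mono[of d a c] closed le by (simp_all add: le_iff)
  then have "(b \<leadsto> c) \<leadsto> (a \<leadsto> d) = bci_top B"
    by (rule imp_trans_top[rotated 3]) (simp_all add: closed imp_closed)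
  then have lo_w: "lo B (bci_interval B (b \<leadsto> c) (a \<leadsto> d)) = b \<leadsto> c"
    by (intro lo_interval) (simp_all add: closed imp_closed le_iff)
  have lo_t: "lo B (bci_interval B (bci_top B) (bci_top B)) = bci_top B"
    by (intro lo_interval) (simp_all add: top_closed C3 le_iff)
  \<comment> \<open>The ends form a chain: \<open>a\<close> below \<open>b\<close> below
    \<open>c\<close> below \<open>d\<close>.\<close>
  have "b \<leadsto> c = bci_top B \<Longrightarrow> a \<leadsto> d = bci_top B"
    using imp_trans_top[of a b c] imp_trans_top[of a c d] closed le by blast
  then show ?thesis
    unfolding w t ends(2,3)[symmetric] using lo_w lo_t by auto
qed

text \<open>The upper end is \<top> because \<open>lo B X\<close> lies below \<open>lo B Y\<close>,
  hence below \<open>hi B Y\<close>. The two intervals then have identical ends as terms, so no end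
  has to be recovered from a set.\<close>

lemma imp_topI:
  assumes "X \<in> carrier (ibci_of B)" "Y \<in> carrier (ibci_of B)"
    and "lo B X \<leadsto> lo B Y = bci_top B" "hi B X \<leadsto> hi B Y = bci_top B"
  shows "ibci_imp (ibci_of B) X Y = ibci_top (ibci_of B)"
proof -
  have "lo B X \<leadsto> hi B Y = bci_top B"
    by (rule imp_trans_top[of _ "lo B Y"]) (simp_all add: assms lo_closed hi_closed lo_imp_hi)
  then show ?thesis
    using assms meet_idem[OF top_closed] by (simp add: ibci_of_def)
qed

lemma wimp_top_imp_top:
  assumes X: "X \<in> carrier (ibci_of B)" and Y: "Y \<in> carrier (ibci_of B)"
    and w: "ibci_wimp (ibci_of B) X Y = ibci_top (ibci_of B)"
  shows "ibci_imp (ibci_of B) X Y = ibci_top (ibci_of B)"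
proof (rule imp_topI[OF X Y])
  have hi_lo: "hi B X \<leadsto> lo B Y = bci_top B"
    using w wimp_top_iff[OF X Y] by simp
  show "lo B X \<leadsto> lo B Y = bci_top B"
    by (rule imp_trans_top[of _ "hi B X"]) (simp_all add: X Y hi_lo lo_closed hi_closed lo_imp_hi)
  show "hi B X \<leadsto> hi B Y = bci_top B"
    by (rule imp_trans_top[of _ "lo B Y"]) (simp_all add: X Y hi_lo lo_closed hi_closed lo_imp_hi)
qed

lemma imp_refl_top:
  assumes "X \<in> carrier (ibci_of B)"
  shows "ibci_imp (ibci_of B) X X = ibci_top (ibci_of B)"
  using assms by (intro imp_topI C3 lo_closed hi_closed)

end

text \<open>The two-element Boolean algebra with classical implication. Its induced order is the
  usual one on 0 and 1, so it has a nondegenerate interval, which a one-element algebra cannot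
  have.\<close>

definition two_bci :: "nat bci" where
  "two_bci = \<lparr>carrier = {0, 1}, bci_imp = (\<lambda>x y. if x \<le> y then 1 else 0), bci_top = 1\<rparr>"

lemma two_bci_simps:
  "carrier two_bci = {0, 1}"
  "x \<leadsto>\<^bsub>two_bci\<^esub> y = (if x \<le> y then 1 else 0)"
  "bci_top two_bci = 1"
  by (simp_all add: two_bci_def)

lemma order_two_bci:
  "carrier (bci_order two_bci) = {0, 1}"
  "(.=\<^bsub>bci_order two_bci\<^esub>) = (=)"
  "x \<sqsubseteq>\<^bsub>bci_order two_bci\<^esub> y \<longleftrightarrow> x \<le> y"
  by (simp_all add: bci_order_def two_bci_def)

lemma partial_order_two_bci: "partial_order (bci_order two_bci)"
  by unfold_locales (auto simp: order_two_bci)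

lemma greatest_two_bci:
  assumes "x \<in> {0, 1}" "y \<in> {0, 1}"
  shows "greatest (bci_order two_bci) (min x y) (Lower (bci_order two_bci) {x, y})"
  using assms by (auto simp: greatest_def Lower_def order_two_bci)

lemma meet_two_bci:
  assumes "x \<in> {0, 1}" "y \<in> {0, 1}"
  shows "bci_meet two_bci x y = min x y"
proof -
  interpret partial_order "bci_order two_bci"
    by (rule partial_order_two_bci)
  show ?thesis
    unfolding meet_def inf_def
    \<comment> \<open>The meet is a choice among greatest lower bounds; antisymmetry leaves only
      \<open>min x y\<close> to choose.\<close>
    by (rule some_equality) (use greatest_two_bci[OF assms] greatest_unique in blast)+
qed

lemma semilattice_two_bci: "semilattice_bci_algebra two_bci"
proof -
  interpret partial_order "bci_order two_bci"
    by (rule partial_order_two_bci)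
  have "lower_semilattice (bci_order two_bci)"
  proof unfold_locales
    fix x y assume "x \<in> carrier (bci_order two_bci)" "y \<in> carrier (bci_order two_bci)"
    then show "\<exists>s. greatest (bci_order two_bci) s (Lower (bci_order two_bci) {x, y})"
      using greatest_two_bci[of x y] by (auto simp: order_two_bci)
  qed
  moreover have "bci_algebra two_bci"
    by (rule bci_algebra.intro) (auto simp: two_bci_simps)
  moreover have "x \<leadsto>\<^bsub>two_bci\<^esub> bci_meet two_bci y z
      = bci_meet two_bci (x \<leadsto>\<^bsub>two_bci\<^esub> y) (x \<leadsto>\<^bsub>two_bci\<^esub> z)"
    if "x \<in> carrier two_bci" "y \<in> carrier two_bci" "z \<in> carrier two_bci" for x y z
    using that by (auto simp: two_bci_simps meet_two_bci)
  ultimately show ?thesis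
    by (simp add: semilattice_bci_algebra_def semilattice_bci_algebra_axioms_def)
qed

text \<open>One diagonal pair refutes both equivalences, since each of them would make the two
  arrows reach the top interval together.\<close>

lemma ibci_imp_top_without_wimp_top:
  obtains I :: "nat set ibci" and X where "ibci_algebra I" "X \<in> carrier I"
    "ibci_imp I X X = ibci_top I" "ibci_wimp I X X \<noteq> ibci_top I"
proof -
  interpret semilattice_bci_algebra two_bci
    by (rule semilattice_two_bci)
  \<comment> \<open>On the diagonal, \<open>wimp_top_iff\<close> asks for the upper end to imply the
    lower end; here 1 implies 0 has the value 0, which is not \<top>.\<close>
  let ?X = "bci_interval two_bci 0 1"
  have ends: "0 \<in> carrier two_bci" "1 \<in> carrier two_bci" "0 \<sqsubseteq>\<^bsub>bci_order two_bci\<^esub> 1"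
    by (simp_all add: order_two_bci two_bci_simps)
  then have X: "?X \<in> carrier (ibci_of two_bci)"
    unfolding ibci_of_def bci_intervals_def by auto
  have "lo two_bci ?X = 0" "hi two_bci ?X = 1"
    using lo_interval[OF ends] hi_interval[OF ends] by simp_all
  then have "hi two_bci ?X \<leadsto>\<^bsub>two_bci\<^esub> lo two_bci ?X \<noteq> bci_top two_bci"
    by (simp add: two_bci_simps)
  then show thesis
    using that[of "ibci_of two_bci" ?X] X wimp_top_iff[OF X X] imp_refl_top[OF X]
      semilattice_two_bci by (auto simp: ibci_algebra_def)
qed

theorem theorem5:
  shows "\<not> (\<forall>I :: nat set ibci. ibci_algebra I \<longrightarrow>
            (\<forall>X \<in> carrier I. \<forall>Y \<in> carrier I. ibci_ll I X Y \<longleftrightarrow> ibci_imp I X Y = ibci_top I))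
       \<and> \<not> (\<forall>I :: nat set ibci. ibci_algebra I \<longrightarrow>
            (\<forall>X \<in> carrier I. \<forall>Y \<in> carrier I. ibci_precsim I X Y \<longleftrightarrow> ibci_wimp I X Y = ibci_top I))
       \<and> (\<forall>I :: 'a set ibci. ibci_algebra I \<longrightarrow>
            (\<forall>X \<in> carrier I. \<forall>Y \<in> carrier I.
               (ibci_ll I X Y \<longrightarrow> ibci_imp I X Y = ibci_top I) \<and>
               (ibci_wimp I X Y = ibci_top I \<longrightarrow> ibci_precsim I X Y)))"
proof -
  obtain I :: "nat set ibci" and X where "ibci_algebra I" "X \<in> carrier I"
    "ibci_imp I X X = ibci_top I" "ibci_wimp I X X \<noteq> ibci_top I"
    by (rule ibci_imp_top_without_wimp_top)
  \<comment> \<open>After unfolding \<open>ibci_ll\<close> and \<open>ibci_precsim\<close>, claims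
    (a) and (b) are both this implication.\<close>
  moreover have "ibci_imp J Y Z = ibci_top J"
    if "ibci_algebra J" "Y \<in> carrier J" "Z \<in> carrier J" "ibci_wimp J Y Z = ibci_top J"
    for J :: "'a set ibci" and Y Z
    using that semilattice_bci_algebra.wimp_top_imp_top unfolding ibci_algebra_def by blast
  ultimately show ?thesis
    unfolding ibci_ll_def ibci_precsim_def by blast
qed

end
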